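(* Let $k\ge 0$ be an integer. A nonempty alternating dimap $G$ has genus $<k$ if and only if none of its minors is a disjoint union of posies of total genus $k$.
   Context: An \emph{alternating dimap} is a finite directed graph (loops and multiple edges allowed) without isolated vertices, 2-cell-embedded in a disjoint union of oriented surfaces (orientable 2-manifolds, one for each component), such that around each vertex the incident edges are directed alternately into and out of the vertex. The empty alternating dimap is allowed. All edges around a face go in the same direction; a face is a \emph{c-face} (clockwise) or \emph{a-face} (anticlockwise) accordingly. An \emph{in-star} is the set of all edges directed into some vertex. Each edge $e$ lies in exactly one c-face $C(e)$, one a-face $A(e)$ and one in-star $I(e)$. The \emph{left successor} (resp. \emph{right successor}) of $e$ is the next edge after $e$ going around $A(e)$ (resp. $C(e)$) in the direction of $e$. Let $\omega=\exp(2\pi i/3)$. The permutations $\sigma_1,\sigma_\omega,\sigma_{\omega^2}$ of $E(G)$ send $e$ to the next edge in clockwise order around $I(e)$, $A(e)$, $C(e)$ respectively. They satisfy $\sigma_1\sigma_\omega\sigma_{\omega^2}=\mathrm{id}$ (rightmost applied first), and alternating dimaps correspond bijectively to triples of permutations of a finite set satisfying this identity: vertices, a-faces and c-faces are the cycles of $\sigma_1,\sigma_\omega,\sigma_{\omega^2}$, and components are the orbits of the generated group. \emph{Minor operations.} Let $e$ be an edge from $u$ to $v$. $G[1]e$: if $e$ is not a loop, delete $e$ and identify its endpoints, preserving the order of edges and faces around vertices; if $e$ alone forms an a-face or a c-face, delete $e$; if $e$ is any other loop, with cyclic order of edge-ends around $v$ being $e$ (directed in)$,a_1,b_1,\ldots,a_k,b_k,e$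 (directed out)$,c_1,d_1,\ldots,c_l,d_l$, delete $e$ and replace $v$ by two vertices $v_1,v_2$, with the ends $a_i,b_i$ reattached to $v_1$ and the ends $c_i,d_i$ to $v_2$, in the induced cyclic orders. $G[\omega]e$: delete $e$ and, if the left successor $g$ of $e$ is not $e$, change the tail of $g$ from $v$ to $u$ so that $g$ takes the place of $e,g$ in $A(e)$. $G[\omega^2]e$: delete $e$ and, if the right successor $f$ of $e$ is not $e$, change the tail of $f$ from $v$ to $u$ so that $f$ takes the place of $e,f$ in $C(e)$. A vertex left without edges disappears. Equivalently, with $\pi\setminus e$ the permutation obtained from $\pi$ by removing $e$ from its cycle: in $G[1]e$, $\sigma_\omega,\sigma_{\omega^2}$ become $\sigma_\omega\setminus e,\sigma_{\omega^2}\setminus e$; in $G[\omega]e$, $\sigma_1,\sigma_\omega$ become $\sigma_1\setminus e,\sigma_\omega\setminus e$; in $G[\omega^2]e$, $\sigma_1,\sigma_{\omega^2}$ become $\sigma_1\setminus e,\sigma_{\omega^2}\setminus e$; the third permutation is determined by the product identity. A \emph{minor} of $G$ is an alternating dimap obtained from $G$ by a (possibly empty) sequence of these operations. The \emph{genus} $\gamma(G)$ is defined by $|V(G)|-|E(G)|+|F(G)|=2(k(G)-\gamma(G))$, where $F(G)$ is the set of faces (a-faces and c-faces) and $k(G)$ the number of components. A \emph{posy} (or $k$-posy) is an alternating dimap with one vertex, $2k+1$ edges (all loops) and two faces; its genus is $k$ ($k\geq 0$). The total genus of a disjoint union of posies is the sum of their genera. *)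

theory Defs
  imports Complex_Main "HOL-Library.Disjoint_Sets" "HOL-Combinatorics.Orbits"
begin

text \<open>
  An alternating dimap is given by its finite edge set and the three permutations that send an
  edge \<open>e\<close> to the next edge clockwise around its in-star, its a-face and its c-face.
  Vertices (which are never isolated), a-faces and c-faces are the cycles of these permutations;
  the 2-cell embedding is determined by them.  In this encoding the right successor of \<open>e\<close>
  is \<open>sigmaW2 G e\<close>, the left successor of \<open>e\<close> is \<open>inv (sigmaW G) e\<close> (an a-face is directed
  anticlockwise), and around each vertex, clockwise, the incoming end of \<open>e\<close> is followed by the
  outgoing end of its left successor, while the outgoing end of \<open>e\<close> is followed by the
  incoming end of \<open>inv (sigmaW2 G) e\<close>.
\<close>

record 'e dimap =
  edges :: "'e set"
  sigma1 :: "'e \<Rightarrow> 'e"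
  sigmaW :: "'e \<Rightarrow> 'e"
  sigmaW2 :: "'e \<Rightarrow> 'e"

definition alternating_dimap :: "'e dimap \<Rightarrow> bool" where
  "alternating_dimap G \<longleftrightarrow> finite (edges G) \<and>
     sigma1 G permutes edges G \<and> sigmaW G permutes edges G \<and> sigmaW2 G permutes edges G \<and>
     sigma1 G \<circ> sigmaW G \<circ> sigmaW2 G = id"

definition vertices :: "'e dimap \<Rightarrow> 'e set set" where
  "vertices G = orbit (sigma1 G) ` edges G"

definition a_faces :: "'e dimap \<Rightarrow> 'e set set" where
  "a_faces G = orbit (sigmaW G) ` edges G"

definition c_faces :: "'e dimap \<Rightarrow> 'e set set" where
  "c_faces G = orbit (sigmaW2 G) ` edges G"

text \<open>The sum is disjoint because an a-face and a c-face may have the same edge set.\<close>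

definition faces :: "'e dimap \<Rightarrow> ('e set + 'e set) set" where
  "faces G = a_faces G <+> c_faces G"

definition step_rel :: "'e dimap \<Rightarrow> ('e \<times> 'e) set" where
  "step_rel G = {(e, s e) | e s. e \<in> edges G \<and> s \<in> {sigma1 G, sigmaW G, sigmaW2 G}}"

text \<open>Orbits of the group generated by the three permutations.\<close>

definition components :: "'e dimap \<Rightarrow> 'e set set" where
  "components G = edges G // (step_rel G \<union> (step_rel G)\<inverse>)\<^sup>*"

text \<open>This is the equation \<open>V - E + F = 2 (k - genus)\<close> solved for the genus; taking real values
  avoids presupposing parity.\<close>

definition genus :: "'e dimap \<Rightarrow> real" where
  "genus G = real (card (components G)) -
     (real (card (vertices G)) - real (card (edges G)) + real (card (faces G))) / 2"

definition remove_from_cycle :: "'e \<Rightarrow> ('e \<Rightarrow> 'e) \<Rightarrow> 'e \<Rightarrow> 'e" where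
  "remove_from_cycle e p x = (if x = e then e else if p x = e then p e else p x)"

text \<open>In each minor operation, the permutation not obtained by removing \<open>e\<close> from a cycle is the
  one forced by the product identity.\<close>

definition minor1 :: "'e dimap \<Rightarrow> 'e \<Rightarrow> 'e dimap" where
  "minor1 G e =
     (let b = remove_from_cycle e (sigmaW G); c = remove_from_cycle e (sigmaW2 G)
      in \<lparr>edges = edges G - {e}, sigma1 = inv (b \<circ> c), sigmaW = b, sigmaW2 = c\<rparr>)"

definition minorW :: "'e dimap \<Rightarrow> 'e \<Rightarrow> 'e dimap" where
  "minorW G e =
     (let a = remove_from_cycle e (sigma1 G); b = remove_from_cycle e (sigmaW G)
      in \<lparr>edges = edges G - {e}, sigma1 = a, sigmaW = b, sigmaW2 = inv (a \<circ> b)\<rparr>)"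

definition minorW2 :: "'e dimap \<Rightarrow> 'e \<Rightarrow> 'e dimap" where
  "minorW2 G e =
     (let a = remove_from_cycle e (sigma1 G); c = remove_from_cycle e (sigmaW2 G)
      in \<lparr>edges = edges G - {e}, sigma1 = a, sigmaW = inv a \<circ> inv c, sigmaW2 = c\<rparr>)"

inductive is_minor :: "'e dimap \<Rightarrow> 'e dimap \<Rightarrow> bool" for G where
  refl: "is_minor G G"
| minor1: "is_minor G H \<Longrightarrow> e \<in> edges H \<Longrightarrow> is_minor G (minor1 H e)"
| minorW: "is_minor G H \<Longrightarrow> e \<in> edges H \<Longrightarrow> is_minor G (minorW H e)"
| minorW2: "is_minor G H \<Longrightarrow> e \<in> edges H \<Longrightarrow> is_minor G (minorW2 H e)"

definition k_posy :: "nat \<Rightarrow> 'e dimap \<Rightarrow> bool" where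
  "k_posy k P \<longleftrightarrow> alternating_dimap P \<and>
     card (vertices P) = 1 \<and> card (edges P) = 2 * k + 1 \<and> card (faces P) = 2"

definition posy :: "'e dimap \<Rightarrow> bool" where
  "posy P \<longleftrightarrow> (\<exists>k. k_posy k P)"

definition disjoint_union_of :: "'e dimap \<Rightarrow> 'e dimap set \<Rightarrow> bool" where
  "disjoint_union_of G Ps \<longleftrightarrow> alternating_dimap G \<and> finite Ps \<and>
     disjoint_family_on edges Ps \<and> edges G = (\<Union>P\<in>Ps. edges P) \<and>
     (\<forall>P\<in>Ps. \<forall>e\<in>edges P.
        sigma1 P e = sigma1 G e \<and> sigmaW P e = sigmaW G e \<and> sigmaW2 P e = sigmaW2 G e)"

text \<open>Posies have edges, so distinct members of a family with pairwise disjoint edge sets are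
  distinct dimaps and a set of posies suffices.  The empty dimap is the union of the empty
  family.\<close>

definition disjoint_union_of_posies :: "'e dimap \<Rightarrow> nat \<Rightarrow> bool" where
  "disjoint_union_of_posies G k \<longleftrightarrow>
     (\<exists>Ps. disjoint_union_of G Ps \<and> (\<forall>P\<in>Ps. posy P) \<and> (\<Sum>P\<in>Ps. genus P) = real k)"

lemma remove_from_cycle_eq:
  assumes "bij p"
  shows "remove_from_cycle e p = transpose e (p e) \<circ> p"
proof
  fix x
  have "p x = p e \<longleftrightarrow> x = e" using assms by (simp add: bij_is_inj inj_eq)
  then show "remove_from_cycle e p x = (transpose e (p e) \<circ> p) x"
    by (auto simp: remove_from_cycle_def transpose_def)
qed

lemma remove_from_cycle_permutes:
  assumes "p permutes E" "e \<in> E"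
  shows "remove_from_cycle e p permutes (E - {e})"
proof -
  have "p e \<in> E" using assms by (simp add: permutes_in_image)
  then have "transpose e (p e) \<circ> p permutes E"
    using assms by (intro permutes_compose permutes_swap_id) auto
  then have "remove_from_cycle e p permutes E"
    using assms by (simp add: remove_from_cycle_eq permutes_bij)
  moreover have "remove_from_cycle e p e = e"
    by (simp add: remove_from_cycle_def)
  ultimately show ?thesis
    by (auto intro!: permutes_superset[of _ E])
qed

lemma minor_alternating_dimap:
  assumes "alternating_dimap G" "e \<in> edges G"
  shows "alternating_dimap (minor1 G e)"
    and "alternating_dimap (minorW G e)"
    and "alternating_dimap (minorW2 G e)"
proof -
  let ?E = "edges G - {e}"
  define a b c where "a = remove_from_cycle e (sigma1 G)"
    and "b = remove_from_cycle e (sigmaW G)" and "c = remove_from_cycle e (sigmaW2 G)"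
  have fin: "finite ?E" and p: "a permutes ?E" "b permutes ?E" "c permutes ?E"
    using assms by (auto simp: alternating_dimap_def a_def b_def c_def
        intro: remove_from_cycle_permutes)
  have "inv (b \<circ> c) permutes ?E" "inv (b \<circ> c) \<circ> b \<circ> c = id"
    using p permutes_inv_o(2)[OF permutes_compose[OF p(3) p(2)]]
    by (auto intro: permutes_inv permutes_compose simp: comp_assoc)
  with fin p show "alternating_dimap (minor1 G e)"
    by (simp add: minor1_def Let_def alternating_dimap_def flip: b_def c_def)
  have "inv (a \<circ> b) permutes ?E" "a \<circ> b \<circ> inv (a \<circ> b) = id"
    using p permutes_inv_o(1)[OF permutes_compose[OF p(2) p(1)]]
    by (auto intro: permutes_inv permutes_compose)
  with fin p show "alternating_dimap (minorW G e)"
    by (simp add: minorW_def Let_def alternating_dimap_def flip: a_def b_def)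
  have "inv a \<circ> inv c permutes ?E" "a \<circ> (inv a \<circ> inv c) \<circ> c = id"
    using p permutes_inv_o(1)[OF p(1)] permutes_inv_o(2)[OF p(3)]
    by (auto intro: permutes_inv permutes_compose simp: fun_eq_iff)
  with fin p show "alternating_dimap (minorW2 G e)"
    by (simp add: minorW2_def Let_def alternating_dimap_def flip: a_def c_def)
qed

lemma is_minor_alternating_dimap:
  "is_minor G H \<Longrightarrow> alternating_dimap G \<Longrightarrow> alternating_dimap H"
  by (induction rule: is_minor.induct) (auto intro: minor_alternating_dimap)

end

theory Submission
  imports Defs
begin

text \<open>
  A reduction lowers the genus by 0 or 1, since up to the removal of one point it multiplies one
  of the three permutations by a transposition, and it disconnects a component into at most two.
  For \<^const>\<open>minor1\<close> the genus can only drop if \<open>sigmaW G e\<close> lies on the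
  vertex cycle of \<open>e\<close>.  Hence in a minor with fewest edges among those of genus at least
  \<open>k\<close> every a-face cycle lies in a vertex cycle and, by the cyclic symmetry of the three
  permutations, every vertex cycle in a c-face cycle and every c-face cycle in an a-face cycle.  So
  all three permutations have the same cycles, each component is a posy (its number of edges is odd
  because the genus is an integer), and the genus is exactly \<open>k\<close>.  The converse is
  monotonicity of the genus under minors.
\<close>

section \<open>Partitions given by their class maps\<close>

text \<open>A partition is encoded by the map sending each element to its block, so that its blocks
  are counted by the image of \<open>E\<close>. Cycles of permutations and components of dimaps then
  share the same counting lemmas.\<close>

definition class_fun :: "'a set \<Rightarrow> ('a \<Rightarrow> 'a set) \<Rightarrow> bool" where
  "class_fun E f \<longleftrightarrow> (\<forall>x\<in>E. x \<in> f x \<and> f x \<subseteq> E \<and> (\<forall>y\<in>f x. f y = f x))"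

lemma class_funD:
  assumes "class_fun E f" "x \<in> E"
  shows "x \<in> f x" "f x \<subseteq> E" "\<And>y. y \<in> f x \<Longrightarrow> f y = f x"
  using assms unfolding class_fun_def by blast+

lemma class_fun_mem_iff:
  assumes "class_fun E f" "x \<in> E" "y \<in> E"
  shows "y \<in> f x \<longleftrightarrow> f y = f x"
  using class_funD[OF assms(1)] assms(2,3) by blast

lemma class_fun_disjoint:
  assumes "class_fun E f" "x \<in> E" "y \<in> E" "f x \<noteq> f y"
  shows "f x \<inter> f y = {}"
  using class_funD(3)[OF assms(1)] assms by blast

text \<open>Passing from \<open>f\<close> to \<open>g\<close> trades two distinct blocks for their
  union, which was not a block of \<open>f\<close>.\<close>

lemma card_classes_merge:
  assumes f: "class_fun E f" and E: "finite E" "u \<in> E" "v \<in> E" and ne: "f u \<noteq> f v"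
    and g: "\<And>x. x \<in> E \<Longrightarrow> g x = (if x \<in> f u \<union> f v then f u \<union> f v else f x)"
  shows "card (f ` E) = card (g ` E) + 1"
proof -
  have g_img: "g ` E = insert (f u \<union> f v) (f ` E - {f u, f v})" (is "_ = ?R")
  proof
    show "g ` E \<subseteq> ?R"
    proof
      fix A assume "A \<in> g ` E"
      then obtain x where x: "x \<in> E" "A = g x" by blast
      moreover have "x \<in> f u \<union> f v" if "f x \<in> {f u, f v}"
        using class_funD(1)[OF f x(1)] that by blast
      ultimately show "A \<in> ?R" using g[OF x(1)] by (cases "x \<in> f u \<union> f v") auto
    qed
    show "?R \<subseteq> g ` E"
    proof
      fix A assume "A \<in> ?R"
      then consider "A = f u \<union> f v" | x where "x \<in> E" "A = f x" "f x \<noteq> f u" "f x \<noteq> f v" by blast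
      then show "A \<in> g ` E"
      proof cases
        case 1
        then have "A = g u" using g E class_funD(1)[OF f E(2)] by simp
        then show ?thesis using E by blast
      next
        case 2
        then have "x \<notin> f u \<union> f v" using class_funD(3)[OF f] E by blast
        then have "A = g x" using 2 g by simp
        then show ?thesis using 2 by blast
      qed
    qed
  qed
  have "f u \<union> f v \<notin> f ` E"
  proof
    assume "f u \<union> f v \<in> f ` E"
    then obtain x where "x \<in> E" "f u \<union> f v = f x" by blast
    then have "f u = f x" "f v = f x" using class_funD[OF f] E by blast+
    then show False using ne by simp
  qed
  then have "card (g ` E) = Suc (card (f ` E - {f u, f v}))"
    using E g_img by (simp add: card_insert_if)
  moreover have "card (f ` E - {f u, f v}) = card (f ` E) - 2"
    using E ne by (subst card_Diff_subset) auto
  moreover have "card {f u, f v} \<le> card (f ` E)" using E by (intro card_mono) auto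
  ultimately show ?thesis using ne by simp
qed

text \<open>A block other than \<open>{e}\<close> keeps a point when \<open>e\<close> is deleted,
  and that point determines the block. Deletion is therefore injective on these blocks, and only
  \<open>{e}\<close> can vanish.\<close>

lemma card_classes_remove:
  assumes f: "class_fun E f" and E: "finite E" "e \<in> E"
  shows "card (f ` E) = card ((\<lambda>x. f x - {e}) ` (E - {e})) + (if f e = {e} then 1 else 0)"
proof -
  let ?D = "\<lambda>A. A - {e}"
  have inj: "inj_on ?D (f ` E - {{e}})"
  proof (rule inj_onI)
    fix A B assume A: "A \<in> f ` E - {{e}}" and B: "B \<in> f ` E - {{e}}" and eq: "A - {e} = B - {e}"
    from A obtain x where x: "x \<in> E" "A = f x" by blast
    from B obtain y where y: "y \<in> E" "B = f y" by blast
    have "A \<noteq> {e}" "A \<noteq> {}" using A x class_funD(1)[OF f] by auto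
    then obtain z where "z \<in> A" "z \<noteq> e" by blast
    then have "z \<in> f x" "z \<in> f y" using eq x y by blast+
    then show "A = B" using class_funD(3)[OF f] x y by metis
  qed
  have "(\<lambda>x. f x - {e}) ` (E - {e}) = ?D ` (f ` E - {{e}})"
  proof
    show "(\<lambda>x. f x - {e}) ` (E - {e}) \<subseteq> ?D ` (f ` E - {{e}})"
      using class_funD(1)[OF f] by fastforce
    show "?D ` (f ` E - {{e}}) \<subseteq> (\<lambda>x. f x - {e}) ` (E - {e})"
    proof
      fix B assume "B \<in> ?D ` (f ` E - {{e}})"
      then obtain x where x: "x \<in> E" "f x \<noteq> {e}" "B = f x - {e}" by blast
      then obtain z where z: "z \<in> f x" "z \<noteq> e" using class_funD(1)[OF f x(1)] by blast
      then have "z \<in> E - {e}" "f z = f x" using class_funD(2,3)[OF f x(1)] by blast+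
      then have "z \<in> E - {e}" "B = f z - {e}" using x by simp_all
      then show "B \<in> (\<lambda>x. f x - {e}) ` (E - {e})" by blast
    qed
  qed
  then have c: "card ((\<lambda>x. f x - {e}) ` (E - {e})) = card (f ` E - {{e}})"
    using card_image[OF inj] by simp
  have "{e} \<in> f ` E \<longleftrightarrow> f e = {e}" using class_funD[OF f] E by (metis imageE image_eqI singletonI)
  moreover have "card (f ` E) > 0" using E by (auto simp: card_gt_0_iff)
  ultimately show ?thesis using c E by (auto simp: card_Diff_singleton_if)
qed

text \<open>Blocks are nonempty, so blocks inside disjoint sets are different and the counts
  add.\<close>

lemma card_classes_disjoint_union:
  assumes "finite I" "\<And>i. i \<in> I \<Longrightarrow> finite (S i)" "disjoint_family_on S I"
    and g: "\<And>i. i \<in> I \<Longrightarrow> class_fun (S i) (g i)"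
    and eq: "\<And>i x. i \<in> I \<Longrightarrow> x \<in> S i \<Longrightarrow> f x = g i x"
  shows "card (f ` (\<Union>i\<in>I. S i)) = (\<Sum>i\<in>I. card (g i ` S i))"
proof -
  have "f ` (\<Union>i\<in>I. S i) = (\<Union>i\<in>I. g i ` S i)"
    using eq by (simp add: image_UN)
  moreover have "g i ` S i \<inter> g j ` S j = {}" if "i \<in> I" "j \<in> I" "i \<noteq> j" for i j
  proof -
    have "S i \<inter> S j = {}" using that assms(3) by (auto simp: disjoint_family_on_def)
    then show ?thesis using class_funD(1,2)[OF g] that by blast
  qed
  ultimately show ?thesis using assms(1,2) by (simp add: card_UN_disjoint)
qed

section \<open>Cycles of permutations\<close>

lemma orbit_subset_closed:
  assumes "x \<in> S" "\<And>y. y \<in> S \<Longrightarrow> p y \<in> S"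
  shows "orbit p x \<subseteq> S"
proof
  fix y assume "y \<in> orbit p x"
  then show "y \<in> S" by induct (use assms in auto)
qed

lemma orbit_eq_if_mem:
  assumes "permutation p" "y \<in> orbit p x"
  shows "orbit p y = orbit p x"
  using assms cyclic_on_orbit' orbit_cyclic_eq3 by metis

lemma mem_orbit_step_iff:
  assumes "permutation p"
  shows "p z \<in> orbit p x \<longleftrightarrow> z \<in> orbit p x"
  using assms by (metis orbit.step orbit_eq_if_mem permutation_orbit_step permutation_self_in_orbit)

lemma class_fun_orbit:
  assumes "p permutes E" "finite E"
  shows "class_fun E (orbit p)"
proof -
  have "permutation p" using assms by (auto simp: permutation_permutes)
  then show ?thesis
    unfolding class_fun_def
    using permutes_orbit_subset[OF assms(1)] orbit_eq_if_mem permutation_self_in_orbit by metis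
qed

text \<open>The transposition only exchanges the targets of the two arrows into \<open>x\<close> and
  \<open>y\<close>. Each of the two cycles continues into the other instead of closing up, and all
  other cycles are untouched.\<close>

lemma transpose_comp_orbit_merge:
  assumes p: "permutation p" and y: "y \<notin> orbit p x"
  shows "orbit (transpose x y \<circ> p) z =
    (if z \<in> orbit p x \<union> orbit p y then orbit p x \<union> orbit p y else orbit p z)"
proof -
  let ?q = "transpose x y \<circ> p" and ?X = "orbit p x" and ?Y = "orbit p y"
  have q: "permutation ?q" using p by (simp add: permutation_compose permutation_swap_id)
  have self: "x \<in> ?X" "y \<in> ?Y" using p by (auto intro: permutation_self_in_orbit)
  have sub: "orbit ?q x \<subseteq> ?X \<union> ?Y"
    using self by (intro orbit_subset_closed) (auto simp: transpose_def intro: orbit.step)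
  \<comment> \<open>If the new cycle of \<open>x\<close> missed \<open>y\<close>, it would follow
    \<open>p\<close> inside \<open>?X\<close>; but \<open>p\<close> sends its last element before
    \<open>x\<close> to \<open>y\<close>, which lies outside \<open>?X\<close>.\<close>
  have yq: "y \<in> orbit ?q x"
  proof (rule ccontr)
    assume ny: "y \<notin> orbit ?q x"
    have "orbit ?q x \<subseteq> ?X \<inter> orbit ?q x"
    proof (rule orbit_subset_closed)
      show "x \<in> ?X \<inter> orbit ?q x" using self permutation_self_in_orbit[OF q] by simp
      fix w assume w: "w \<in> ?X \<inter> orbit ?q x"
      then have "p w \<in> ?X" "?q w \<in> orbit ?q x" by (blast intro: orbit.step)+
      moreover have "p w \<noteq> x" using calculation(2) ny by auto
      moreover have "p w \<noteq> y" using calculation(1) y by blast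
      ultimately show "?q w \<in> ?X \<inter> orbit ?q x" by simp
    qed
    moreover obtain w where "w \<in> orbit ?q x" "?q w = x"
      using permutation_self_in_orbit[OF q, of x]
      by (metis bij_pointE mem_orbit_step_iff[OF q] permutation_bijective[OF q])
    ultimately have "w \<in> ?X" "p w = y"
      by (auto simp: transpose_def split: if_splits)
    then show False using y orbit.step by metis
  qed
  have closed: "p w \<in> orbit ?q x" if "w \<in> orbit ?q x" for w
  proof -
    have "?q w \<in> orbit ?q x" using that by (rule orbit.step)
    then show ?thesis using yq permutation_self_in_orbit[OF q, of x]
      by (auto simp: transpose_def split: if_splits)
  qed
  have "orbit p w \<subseteq> orbit ?q x" if "w \<in> orbit ?q x" for w
    using that closed by (rule orbit_subset_closed)
  then have eq: "orbit ?q x = ?X \<union> ?Y"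
    using sub yq permutation_self_in_orbit[OF q, of x] by blast
  show ?thesis
  proof (cases "z \<in> ?X \<union> ?Y")
    case True
    then show ?thesis using eq orbit_eq_if_mem[OF q] by metis
  next
    case False
    have "orbit ?q z = orbit p z"
    proof (rule orbit_cong)
      show "z \<in> orbit p z" using p by (rule permutation_self_in_orbit)
      fix s assume "s \<in> orbit p z"
      then have "orbit p (p s) = orbit p z" using p by (simp add: orbit_eq_if_mem orbit.step)
      then have "p s \<noteq> x" "p s \<noteq> y"
        using False permutation_self_in_orbit[OF p] by (metis UnCI)+
      then show "?q s = p s" by simp
    qed
    then show ?thesis using False by simp
  qed
qed

text \<open>The segment from \<open>x\<close> up to just before the first visit to \<open>y\<close>
  becomes closed, because the arrow that entered \<open>y\<close> now returns to
  \<open>x\<close>.\<close>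

lemma transpose_comp_orbit_split:
  assumes "y \<in> orbit p x" "x \<noteq> y"
  shows "y \<notin> orbit (transpose x y \<circ> p) x"
proof -
  let ?n = "funpow_dist1 p x y"
  \<comment> \<open>\<open>?n\<close> is the least positive number of \<open>p\<close>-steps from
    \<open>x\<close> to \<open>y\<close>, so this segment avoids \<open>y\<close>.\<close>
  let ?Z = "(\<lambda>i. (p ^^ i) x) ` {..<?n}"
  have y: "(p ^^ ?n) x = y" using assms(1) by (rule funpow_dist1_prop)
  have "orbit (transpose x y \<circ> p) x \<subseteq> ?Z"
  proof (rule orbit_subset_closed)
    show "x \<in> ?Z" by (rule image_eqI[of _ _ 0]) auto
    fix w assume "w \<in> ?Z"
    then obtain i where i: "i < ?n" "w = (p ^^ i) x" by blast
    show "(transpose x y \<circ> p) w \<in> ?Z"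
    proof (cases "Suc i = ?n")
      case True
      then have "p w = y" using i y by (metis funpow.simps(2) o_apply)
      then show ?thesis using \<open>x \<in> ?Z\<close> by simp
    next
      case False
      then have lt: "Suc i < ?n" using i by simp
      have pw: "p w = (p ^^ Suc i) x" using i by simp
      have "(p ^^ Suc i) x \<noteq> (p ^^ 0) x"
        using funpow_neq_less_funpow_dist1[OF assms(1) lt, of 0] by simp
      then have "p w \<noteq> x" "p w \<noteq> y" using funpow_dist1_least[OF _ lt] pw by auto
      then show ?thesis using lt pw by (intro image_eqI[of _ _ "Suc i"]) auto
    qed
  qed
  moreover have "y \<notin> ?Z"
  proof
    assume "y \<in> ?Z"
    then obtain i where i: "i < ?n" "y = (p ^^ i) x" by blast
    then show False using funpow_dist1_least[of i p x y] assms(2) by (cases "i = 0") auto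
  qed
  ultimately show ?thesis by blast
qed

lemma card_orbits_transpose_merge:
  assumes p: "p permutes E" "finite E" and "x \<in> E" "y \<in> E" "y \<notin> orbit p x"
  shows "card (orbit p ` E) = card (orbit (transpose x y \<circ> p) ` E) + 1"
proof -
  have pp: "permutation p" using p by (auto simp: permutation_permutes)
  have "orbit p x \<noteq> orbit p y" using assms permutation_self_in_orbit[OF pp] by blast
  then show ?thesis
    using assms class_fun_orbit[OF p] transpose_comp_orbit_merge[OF pp \<open>y \<notin> orbit p x\<close>]
    by (intro card_classes_merge) auto
qed

lemma card_orbits_transpose_split:
  assumes p: "p permutes E" "finite E" and "x \<in> E" "y \<in> E" "y \<in> orbit p x" "x \<noteq> y"
  shows "card (orbit (transpose x y \<circ> p) ` E) = card (orbit p ` E) + 1"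
proof -
  have "transpose x y \<circ> p permutes E"
    using assms by (intro permutes_compose permutes_swap_id)
  \<comment> \<open>A transposition is its own inverse, so splitting is merging read backwards from
    the composed permutation.\<close>
  then have "card (orbit (transpose x y \<circ> p) ` E)
      = card (orbit (transpose x y \<circ> (transpose x y \<circ> p)) ` E) + 1"
    using assms transpose_comp_orbit_split by (intro card_orbits_transpose_merge)
  then show ?thesis by (simp flip: comp_assoc)
qed

lemma orbit_remove_from_cycle:
  assumes p: "inj p" and x: "x \<noteq> e" and self: "x \<in> orbit p x" "x \<in> orbit (remove_from_cycle e p) x"
  shows "orbit (remove_from_cycle e p) x = orbit p x - {e}"
proof
  let ?r = "remove_from_cycle e p"
  show sub: "orbit ?r x \<subseteq> orbit p x - {e}"
  proof (rule orbit_subset_closed)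
    fix y assume "y \<in> orbit p x - {e}"
    then show "?r y \<in> orbit p x - {e}"
      using p orbit.step[of _ p x] by (auto simp: remove_from_cycle_def inj_eq)
  qed (use self x in simp)
  \<comment> \<open>The new orbit alone is not closed under \<open>p\<close> where \<open>p\<close>
    passes through \<open>e\<close>. Adjoining \<open>e\<close> when its successor lies in the orbit
    repairs this; \<open>insert e\<close> admits the case of a fixed point \<open>e\<close>.\<close>
  let ?S = "orbit ?r x \<union> {y. y = e \<and> p e \<in> insert e (orbit ?r x)}"
  have "orbit p x \<subseteq> ?S"
  proof (rule orbit_subset_closed)
    show "x \<in> ?S" using self by simp
    fix y assume y: "y \<in> ?S"
    show "p y \<in> ?S"
    proof (cases "y = e")
      case False
      then have "?r y \<in> orbit ?r x" using y by (auto intro: orbit.step)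
      then show ?thesis using False by (auto simp: remove_from_cycle_def split: if_splits)
    qed (use y sub in auto)
  qed
  then show "orbit p x - {e} \<subseteq> orbit ?r x" by blast
qed

lemma orbit_remove_from_cycle_permutes:
  assumes "p permutes E" "finite E" "e \<in> E" "x \<noteq> e"
  shows "orbit (remove_from_cycle e p) x = orbit p x - {e}"
proof -
  have "permutation p" "permutation (remove_from_cycle e p)"
    using assms remove_from_cycle_permutes[OF assms(1,3)] by (auto simp: permutation_permutes)
  then show ?thesis
    using assms permutes_inj[OF assms(1)]
    by (intro orbit_remove_from_cycle permutation_self_in_orbit)
qed

lemma card_orbits_remove_from_cycle:
  assumes "p permutes E" "finite E" "e \<in> E"
  shows "card (orbit p ` E) =
    card (orbit (remove_from_cycle e p) ` (E - {e})) + (if p e = e then 1 else 0)"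
proof -
  have "orbit (remove_from_cycle e p) ` (E - {e}) = (\<lambda>x. orbit p x - {e}) ` (E - {e})"
    using assms by (intro image_cong) (auto simp: orbit_remove_from_cycle_permutes)
  then show ?thesis
    using card_classes_remove[OF class_fun_orbit[OF assms(1,2)] assms(2,3)]
    by (simp add: orbit_eq_singleton_iff)
qed


section \<open>Components and genus\<close>

text \<open>Serves to turn the quotient in \<open>components\<close> into the image of a class
  map.\<close>

definition component :: "'e dimap \<Rightarrow> 'e \<Rightarrow> 'e set" where
  "component G x = (step_rel G \<union> (step_rel G)\<inverse>)\<^sup>* `` {x}"

lemma components_altdef: "components G = component G ` edges G"
  by (auto simp: components_def component_def quotient_def)

lemma component_self: "x \<in> component G x"
  by (simp add: component_def)

lemma component_eqI:
  assumes "(x, y) \<in> (step_rel G \<union> (step_rel G)\<inverse>)\<^sup>*"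
  shows "component G y = component G x"
proof -
  have "sym ((step_rel G \<union> (step_rel G)\<inverse>)\<^sup>*)" by (intro sym_rtrancl sym_Un_converse)
  then have "(y, x) \<in> (step_rel G \<union> (step_rel G)\<inverse>)\<^sup>*" using assms by (rule symD)
  then show ?thesis using assms by (auto simp: component_def intro: rtrancl_trans)
qed

lemma component_step:
  assumes "x \<in> edges G" "s \<in> {sigma1 G, sigmaW G, sigmaW2 G}"
  shows "component G (s x) = component G x"
  using assms by (intro component_eqI r_into_rtrancl) (auto simp: step_rel_def)

text \<open>The closure hypothesis is an equivalence because connecting paths may also follow the
  converse of \<open>step_rel\<close>.\<close>

lemma component_subset_closed:
  assumes "x \<in> S"
    and "\<And>y s. y \<in> edges G \<Longrightarrow> s \<in> {sigma1 G, sigmaW G, sigmaW2 G} \<Longrightarrow> s y \<in> S \<longleftrightarrow> y \<in> S"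
  shows "component G x \<subseteq> S"
proof
  fix y assume "y \<in> component G x"
  then have "(x, y) \<in> (step_rel G \<union> (step_rel G)\<inverse>)\<^sup>*" by (simp add: component_def)
  then show "y \<in> S"
  proof induct
    case (step y z)
    then show ?case using assms(2) unfolding step_rel_def by blast
  qed (fact assms(1))
qed

lemma class_fun_component:
  assumes "alternating_dimap G"
  shows "class_fun (edges G) (component G)"
proof -
  have "component G x \<subseteq> edges G" if "x \<in> edges G" for x
    using assms that
    by (intro component_subset_closed) (auto simp: alternating_dimap_def permutes_in_image)
  moreover have "component G y = component G x" if "y \<in> component G x" for x y
    using that by (intro component_eqI) (simp add: component_def)
  ultimately show ?thesis using component_self unfolding class_fun_def by metis
qed

lemma sigmaW_sigmaW2_sigma1:
  assumes "alternating_dimap G"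
  shows "sigmaW G (sigmaW2 G (sigma1 G x)) = x"
proof -
  have a: "sigma1 G permutes edges G" and eq: "sigma1 G \<circ> sigmaW G \<circ> sigmaW2 G = id"
    using assms by (auto simp: alternating_dimap_def)
  have "sigma1 G (sigmaW G (sigmaW2 G (sigma1 G x))) = sigma1 G x"
    using fun_cong[OF eq, of "sigma1 G x"] by simp
  then show ?thesis using permutes_inj[OF a] by (simp add: inj_eq)
qed

text \<open>By the product identity \<open>sigmaW G \<circ> sigmaW2 G\<close> is the inverse of
  \<open>sigma1 G\<close>, so invariance under these two permutations implies invariance under the
  third.\<close>

lemma component_subset_closed_alternating:
  assumes G: "alternating_dimap G" and x: "x \<in> S"
    and W: "\<And>y. y \<in> edges G \<Longrightarrow> sigmaW G y \<in> S \<longleftrightarrow> y \<in> S"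
    and W2: "\<And>y. y \<in> edges G \<Longrightarrow> sigmaW2 G y \<in> S \<longleftrightarrow> y \<in> S"
  shows "component G x \<subseteq> S"
proof -
  have "sigma1 G y \<in> S \<longleftrightarrow> y \<in> S" if "y \<in> edges G" for y
  proof -
    have "sigma1 G y \<in> edges G" "sigmaW2 G (sigma1 G y) \<in> edges G"
      using G that by (auto simp: alternating_dimap_def permutes_in_image)
    then show ?thesis using W W2 sigmaW_sigmaW2_sigma1[OF G] by metis
  qed
  then show ?thesis using assms by (intro component_subset_closed) auto
qed

lemma finite_edges: "alternating_dimap G \<Longrightarrow> finite (edges G)"
  by (simp add: alternating_dimap_def)

lemma genus_altdef:
  assumes "alternating_dimap G"
  shows "genus G = real (card (component G ` edges G)) -
    (real (card (orbit (sigma1 G) ` edges G)) + real (card (orbit (sigmaW G) ` edges G))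
      + real (card (orbit (sigmaW2 G) ` edges G)) - real (card (edges G))) / 2"
  using finite_edges[OF assms]
  by (simp add: genus_def components_altdef vertices_def faces_def a_faces_def c_faces_def
      card_Plus)

section \<open>The effect of a reduction on the genus\<close>

text \<open>\<open>u\<close> and \<open>v\<close> are the images of \<open>e\<close> under
  \<open>sigmaW G\<close> and \<open>sigmaW2 G\<close>, each standing in for the other when
  \<open>e\<close> is a fixed point. As \<open>e\<close> is merely bypassed, the only connection
  that can be lost is the one between \<open>u\<close> and \<open>v\<close>.\<close>

lemma component_minor1:
  fixes G :: "'e dimap"
  assumes G: "alternating_dimap G" and e: "e \<in> edges G"
    and nonfixed: "sigmaW G e \<noteq> e \<or> sigmaW2 G e \<noteq> e"
    and u: "u = (if sigmaW G e = e then sigmaW2 G e else sigmaW G e)"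
    and v: "v = (if sigmaW2 G e = e then sigmaW G e else sigmaW2 G e)"
    and x: "x \<in> edges G - {e}"
  defines "C' \<equiv> component (minor1 G e)"
  shows "component G x - {e} = (if x \<in> C' u \<union> C' v then C' u \<union> C' v else C' x)" (is "_ = ?M")
proof
  let ?E' = "edges G - {e}" and ?b = "sigmaW G" and ?c = "sigmaW2 G" and ?C = "component G"
  let ?b' = "remove_from_cycle e ?b" and ?c' = "remove_from_cycle e ?c"
  have G': "alternating_dimap (minor1 G e)" using G e by (rule minor_alternating_dimap)
  have E': "edges (minor1 G e) = ?E'"
    and b': "sigmaW (minor1 G e) = ?b'" and c': "sigmaW2 (minor1 G e) = ?c'"
    by (simp_all add: minor1_def Let_def)
  have bE: "?b y \<in> edges G \<longleftrightarrow> y \<in> edges G" and cE: "?c y \<in> edges G \<longleftrightarrow> y \<in> edges G" for y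
    using G by (auto simp: alternating_dimap_def permutes_in_image)
  have "inj ?b" "inj ?c" using G by (auto simp: alternating_dimap_def permutes_inj)
  have uv: "u \<in> ?E'" "v \<in> ?E'" using u v nonfixed e bE cE by auto
  have f: "class_fun (edges G) ?C" using G by (rule class_fun_component)
  have f': "class_fun ?E' C'" using class_fun_component[OF G'] by (simp add: C'_def E')
  have C'_b': "C' (?b' y) = C' y" and C'_c': "C' (?c' y) = C' y" if "y \<in> ?E'" for y
    using component_step[of y "minor1 G e"] that by (auto simp: C'_def E' simp flip: b' c')
  have C_b: "?C (?b y) = ?C y" and C_c: "?C (?c y) = ?C y" if "y \<in> edges G" for y
    using component_step[of y G] that by auto
  have mem': "y \<in> C' z \<longleftrightarrow> C' y = C' z" if "y \<in> ?E'" "z \<in> ?E'" for y z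
    using class_fun_mem_iff[OF f'] that by blast
  have mem: "y \<in> ?C z \<longleftrightarrow> ?C y = ?C z" if "y \<in> edges G" "z \<in> edges G" for y z
    using class_fun_mem_iff[OF f] that by blast
  \<comment> \<open>Membership is recast as a condition on the class of \<open>y\<close> alone, so
    that \<open>?M\<close> inherits its invariance from \<open>C'\<close>.\<close>
  have M: "y \<in> ?M \<longleftrightarrow> C' y \<in> (if C' x \<in> {C' u, C' v} then {C' u, C' v} else {C' x})"
    if "y \<in> ?E'" for y
    using mem'[OF that x] mem'[OF that uv(1)] mem'[OF that uv(2)] mem'[OF x uv(1)] mem'[OF x uv(2)]
    by simp
  have M_uv: "u \<in> ?M \<longleftrightarrow> v \<in> ?M" using uv by (auto simp only: M split: if_splits)
  have b'E: "?b' y \<in> ?E'" and c'E: "?c' y \<in> ?E'" if "y \<in> ?E'" for y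
    using G' that unfolding alternating_dimap_def E' b' c' by (simp_all only: permutes_in_image)
  have M_b': "?b' y \<in> ?M \<longleftrightarrow> y \<in> ?M" and M_c': "?c' y \<in> ?M \<longleftrightarrow> y \<in> ?M" if "y \<in> ?E'" for y
    using that b'E c'E by (simp_all only: M C'_b' C'_c')
  have eM: "e \<notin> ?M" using class_funD(2)[OF f'] uv x by auto
  \<comment> \<open>\<open>e\<close> must be adjoined exactly when its neighbours \<open>u\<close>
    and \<open>v\<close> belong to \<open>?M\<close>; by \<open>M_uv\<close> it suffices to test
    \<open>u\<close>.\<close>
  let ?S = "?M \<union> {y. y = e \<and> u \<in> ?M}"
  have S_e: "e \<in> ?S \<longleftrightarrow> u \<in> ?M" and S: "y \<noteq> e \<Longrightarrow> y \<in> ?S \<longleftrightarrow> y \<in> ?M" for y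
    using eM by simp_all
  have "?C x \<subseteq> ?S"
  proof (rule component_subset_closed_alternating[OF G])
    show "x \<in> ?S" using x M[of x] by simp
    fix y assume y: "y \<in> edges G"
    show "?b y \<in> ?S \<longleftrightarrow> y \<in> ?S"
    proof (cases "y = e")
      case True
      then show ?thesis using S_e S[of "?b e"] u by (cases "?b e = e") simp_all
    next
      case False
      then have y': "y \<in> ?E'" using y by simp
      show ?thesis
      proof (cases "?b y = e")
        case True
        then have "?b e \<noteq> e" using False \<open>inj ?b\<close> by (metis injD)
        then have "?b' y = u" using True False u by (simp add: remove_from_cycle_def)
        then show ?thesis using M_b'[OF y'] S_e S[OF False] True by simp
      next
        case b: False
        then have "?b' y = ?b y" using False by (simp add: remove_from_cycle_def)
        then show ?thesis using M_b'[OF y'] S[OF False] S[OF b] by simp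
      qed
    qed
    show "?c y \<in> ?S \<longleftrightarrow> y \<in> ?S"
    proof (cases "y = e")
      case True
      then show ?thesis using S_e S[of "?c e"] v M_uv by (cases "?c e = e") simp_all
    next
      case False
      then have y': "y \<in> ?E'" using y by simp
      show ?thesis
      proof (cases "?c y = e")
        case True
        then have "?c e \<noteq> e" using False \<open>inj ?c\<close> by (metis injD)
        then have "?c' y = v" using True False v by (simp add: remove_from_cycle_def)
        then show ?thesis using M_c'[OF y'] S_e S[OF False] True M_uv by simp
      next
        case c: False
        then have "?c' y = ?c y" using False by (simp add: remove_from_cycle_def)
        then show ?thesis using M_c'[OF y'] S[OF False] S[OF c] by simp
      qed
    qed
  qed
  then show "?C x - {e} \<subseteq> ?M" by blast
  \<comment> \<open>For the reverse inclusion: a bypass of \<open>e\<close> amounts to two steps of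
    the old permutation, so components of the minor stay inside components of
    \<open>G\<close>.\<close>
  have C_b': "?C (?b' y) = ?C y" and C_c': "?C (?c' y) = ?C y" if "y \<in> edges G" for y
    using that C_b C_c e by (auto simp: remove_from_cycle_def)
  have sub: "C' z \<subseteq> ?C z" if z: "z \<in> ?E'" for z
    unfolding C'_def
  proof (rule component_subset_closed_alternating[OF G'])
    show "z \<in> ?C z" by (rule component_self)
    fix y assume "y \<in> edges (minor1 G e)"
    then have y: "y \<in> ?E'" by (simp add: E')
    then have "?b' y \<in> edges G" "?c' y \<in> edges G" "y \<in> edges G" "z \<in> edges G"
      using b'E c'E z by blast+
    then show "sigmaW (minor1 G e) y \<in> ?C z \<longleftrightarrow> y \<in> ?C z"
      and "sigmaW2 (minor1 G e) y \<in> ?C z \<longleftrightarrow> y \<in> ?C z"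
      unfolding b' c' by (simp_all only: mem C_b' C_c')
  qed
  have "?C u = ?C e" "?C v = ?C e" using u v e C_b C_c by auto
  then have uv_sub: "C' u \<union> C' v \<subseteq> ?C e" using sub[OF uv(1)] sub[OF uv(2)] by simp
  moreover have "?C x = ?C e" if "x \<in> C' u \<union> C' v"
    using class_funD(3)[OF f e] uv_sub that by blast
  ultimately have "?M \<subseteq> ?C x" using sub[OF x] by simp
  then show "?M \<subseteq> ?C x - {e}" using eM by blast
qed


text \<open>If both permutations fix \<open>e\<close>, it is a whole component and vanishes. If just
  one does, \<open>u\<close> and \<open>v\<close> of \<open>component_minor1\<close> coincide and
  nothing separates. Otherwise the component of \<open>e\<close> splits precisely when the two
  images of \<open>e\<close> become disconnected.\<close>

lemma card_component_minor1:
  fixes G :: "'e dimap"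
  assumes G: "alternating_dimap G" and e: "e \<in> edges G"
  defines "E' \<equiv> edges G - {e}" and "C' \<equiv> component (minor1 G e)"
  shows "sigmaW G e = e \<Longrightarrow> sigmaW2 G e = e \<Longrightarrow>
      card (component G ` edges G) = card (C' ` E') + 1"
    and "(sigmaW G e = e) \<noteq> (sigmaW2 G e = e) \<Longrightarrow>
      card (component G ` edges G) = card (C' ` E')"
    and "sigmaW G e \<noteq> e \<Longrightarrow> sigmaW2 G e \<noteq> e \<Longrightarrow>
      card (C' ` E') = card (component G ` edges G)
        + (if C' (sigmaW G e) = C' (sigmaW2 G e) then 0 else 1)"
proof -
  let ?b = "sigmaW G" and ?c = "sigmaW2 G" and ?C = "component G"
  have f: "class_fun (edges G) ?C" using G by (rule class_fun_component)
  have G': "alternating_dimap (minor1 G e)" using G e by (rule minor_alternating_dimap)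
  have E': "edges (minor1 G e) = E'" by (simp_all add: minor1_def E'_def Let_def)
  have f': "class_fun E' C'" using class_fun_component[OF G'] by (simp add: C'_def E')
  have remove: "card (?C ` edges G) =
      card ((\<lambda>x. ?C x - {e}) ` E') + (if ?C e = {e} then 1 else 0)"
    using card_classes_remove[OF f finite_edges[OF G] e] by (simp add: E'_def)
  have bE: "?b e \<in> edges G" and cE: "?c e \<in> edges G"
    using G e by (auto simp: alternating_dimap_def permutes_in_image)
  have mem: "?b e \<in> ?C e" "?c e \<in> ?C e"
    using component_step[OF e, of ?b] component_step[OF e, of ?c] component_self by force+
  {
    assume fixed: "?b e = e" "?c e = e"
    have "inj ?b" "inj ?c" using G by (auto simp: alternating_dimap_def permutes_inj)
    then have ne: "?b y = e \<longleftrightarrow> y = e" "?c y = e \<longleftrightarrow> y = e" for y using fixed by (metis injD)+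
    have "?C e \<subseteq> {e}"
      using ne by (intro component_subset_closed_alternating[OF G]) auto
    then have Ce: "?C e = {e}" using component_self[of e G] by blast
    have same: "sigmaW (minor1 G e) = ?b" "sigmaW2 (minor1 G e) = ?c"
      using fixed G
      by (auto simp: minor1_def Let_def alternating_dimap_def remove_from_cycle_eq[OF permutes_bij])
    have "?C x - {e} = C' x" if x: "x \<in> E'" for x
    proof
      have sub: "?C x \<subseteq> insert e (C' x)"
      proof (rule component_subset_closed_alternating[OF G])
        show "x \<in> insert e (C' x)" by (simp add: C'_def component_self)
        have "s y \<in> insert e (C' x) \<longleftrightarrow> y \<in> insert e (C' x)"
          if "y \<in> edges G" "s \<in> {?b, ?c}" for y s
        proof (cases "y = e")
          case False
          have "s permutes edges G" using that(2) G by (auto simp: alternating_dimap_def)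
          then have "s y \<in> edges G" using that(1) by (simp only: permutes_in_image)
          moreover have "s y \<noteq> e" using that(2) ne[of y] False by blast
          ultimately have y: "y \<in> E'" "s y \<in> E'" using that(1) False by (simp_all add: E'_def)
          have "C' (s y) = C' y"
            using component_step[of y "minor1 G e"] y that same by (auto simp: C'_def E')
          then have "s y \<in> C' x \<longleftrightarrow> y \<in> C' x" using class_fun_mem_iff[OF f' x] y by simp
          then show ?thesis using ne that by auto
        qed (use that fixed in auto)
        then show "?b y \<in> insert e (C' x) \<longleftrightarrow> y \<in> insert e (C' x)"
          "?c y \<in> insert e (C' x) \<longleftrightarrow> y \<in> insert e (C' x)" if "y \<in> edges G" for y
          using that by blast+
      qed
      then show "?C x - {e} \<subseteq> C' x" by blast
      have "C' x \<subseteq> ?C x" unfolding C'_def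
      proof (rule component_subset_closed_alternating[OF G'])
        show "x \<in> ?C x" by (rule component_self)
        fix y assume "y \<in> edges (minor1 G e)"
        then have y: "y \<in> edges G" by (simp add: E' E'_def)
        then have "?b y \<in> edges G" "?c y \<in> edges G"
          using G by (auto simp: alternating_dimap_def permutes_in_image)
        moreover have "?C (?b y) = ?C y" "?C (?c y) = ?C y" using component_step[OF y] by auto
        moreover have "x \<in> edges G" using x by (simp add: E'_def)
        ultimately show "sigmaW (minor1 G e) y \<in> ?C x \<longleftrightarrow> y \<in> ?C x"
          "sigmaW2 (minor1 G e) y \<in> ?C x \<longleftrightarrow> y \<in> ?C x"
          unfolding same using class_fun_mem_iff[OF f] y by simp_all
      qed
      moreover have "e \<notin> C' x" using class_funD(2)[OF f' x] by (auto simp: E'_def)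
      ultimately show "C' x \<subseteq> ?C x - {e}" by blast
    qed
    then have "(\<lambda>x. ?C x - {e}) ` E' = C' ` E'" by (rule image_cong[OF HOL.refl])
    then show "card (?C ` edges G) = card (C' ` E') + 1" using remove Ce by simp
  }
  {
    assume one: "(?b e = e) \<noteq> (?c e = e)"
    then have "?C e \<noteq> {e}" using mem by auto
    moreover have "?C x - {e} = C' x" if x: "x \<in> E'" for x
    proof -
      define u where "u = (if ?b e = e then ?c e else ?b e)"
      have "u \<in> E'" using bE cE one by (auto simp: E'_def u_def)
      then have "C' x = C' u" if "x \<in> C' u" using that by (rule class_funD(3)[OF f'])
      moreover have "?C x - {e} = (if x \<in> C' u \<union> C' u then C' u \<union> C' u else C' x)"
        unfolding C'_def
        by (rule component_minor1[OF G e]) (use one x in \<open>auto simp: E'_def u_def\<close>)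
      ultimately show ?thesis by (cases "x \<in> C' u") simp_all
    qed
    then have "(\<lambda>x. ?C x - {e}) ` E' = C' ` E'" by (rule image_cong[OF HOL.refl])
    ultimately show "card (?C ` edges G) = card (C' ` E')" using remove by simp
  }
  {
    assume ne: "?b e \<noteq> e" "?c e \<noteq> e"
    then have "?C e \<noteq> {e}" using mem by auto
    then have card: "card (?C ` edges G) = card ((\<lambda>x. ?C x - {e}) ` E')" using remove by simp
    let ?u = "?b e" and ?v = "?c e"
    have uv: "?u \<in> E'" "?v \<in> E'" using bE cE ne by (auto simp: E'_def)
    have g: "?C x - {e} = (if x \<in> C' ?u \<union> C' ?v then C' ?u \<union> C' ?v else C' x)" if "x \<in> E'" for x
      unfolding C'_def by (rule component_minor1[OF G e]) (use ne that in \<open>auto simp: E'_def\<close>)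
    show "card (C' ` E') = card (?C ` edges G) + (if C' ?u = C' ?v then 0 else 1)"
    proof (cases "C' ?u = C' ?v")
      case True
      have "?C x - {e} = C' x" if x: "x \<in> E'" for x
        using g[OF x] class_funD(3)[OF f' uv(1), of x] True by (cases "x \<in> C' ?u") simp_all
      then have "(\<lambda>x. ?C x - {e}) ` E' = C' ` E'" by (rule image_cong[OF HOL.refl])
      then show ?thesis using card True by simp
    next
      case False
      have "card (C' ` E') = card ((\<lambda>x. ?C x - {e}) ` E') + 1"
        by (rule card_classes_merge[OF f' _ uv False g])
          (use finite_edges[OF G] in \<open>simp_all add: E'_def\<close>)
      then show ?thesis using card False by simp
    qed
  }
qed

text \<open>The head of \<open>sigmaW G e\<close> is the tail of \<open>e\<close>, so the hypothesis
  of the second claim says that \<open>e\<close> is not a loop; contracting it loses one vertex and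
  one edge. A loop that is not a face splits its vertex, which lowers the genus by one unless the
  component splits too.\<close>

lemma genus_minor1:
  fixes G :: "'e dimap"
  assumes G: "alternating_dimap G" and e: "e \<in> edges G"
  shows "genus (minor1 G e) = genus G \<or> genus (minor1 G e) = genus G - 1"
    and "sigmaW G e \<notin> orbit (sigma1 G) e \<Longrightarrow> genus (minor1 G e) = genus G"
proof -
  let ?E = "edges G" and ?E' = "edges G - {e}"
  let ?a = "sigma1 G" and ?b = "sigmaW G" and ?c = "sigmaW2 G"
  let ?b' = "remove_from_cycle e ?b" and ?c' = "remove_from_cycle e ?c"
  let ?C' = "component (minor1 G e)"
  \<comment> \<open>\<open>d\<close> is the inverse of \<open>?a\<close>, so its cycles are the
    vertices of \<open>G\<close>. \<open>q\<close> is halfway to the minor: \<open>e\<close> is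
    removed from \<open>?c\<close> but not yet from \<open>?b\<close>, and \<open>q\<close> differs
    from \<open>d\<close> by at most one transposition.\<close>
  define d q where "d = ?b \<circ> ?c" and "q = ?b \<circ> ?c'"
  have fin: "finite ?E" and perm: "?a permutes ?E" "?b permutes ?E" "?c permutes ?E"
    and prod: "?a \<circ> ?b \<circ> ?c = id"
    using G by (auto simp: alternating_dimap_def)
  have inj: "inj ?b" "inj ?c" using perm permutes_inj by blast+
  have G': "alternating_dimap (minor1 G e)" using G e by (rule minor_alternating_dimap)
  have E': "edges (minor1 G e) = ?E'" and a': "sigma1 (minor1 G e) = inv (?b' \<circ> ?c')"
    and b': "sigmaW (minor1 G e) = ?b'" and c': "sigmaW2 (minor1 G e) = ?c'"
    by (simp_all add: minor1_def Let_def)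
  have bE: "?b e \<in> ?E" and cE: "?c e \<in> ?E" and dE: "d e \<in> ?E"
    using e perm by (auto simp: d_def permutes_in_image)
  have d_perm: "d permutes ?E" unfolding d_def using perm by (intro permutes_compose)
  have "inv ?a = d"
  proof (rule inv_unique_comp)
    show "?a \<circ> d = id" using prod by (simp add: d_def comp_assoc)
    show "d \<circ> ?a = id" using sigmaW_sigmaW2_sigma1[OF G] by (simp add: d_def fun_eq_iff)
  qed
  then have orbit_a: "orbit ?a = orbit d"
    using orbit_inv_eq[of ?a] perm fin by (metis ext permutation_permutes)
  have q_alt: "q = transpose (?b e) (d e) \<circ> d"
    using inj by (auto simp: q_def d_def remove_from_cycle_def transpose_def inj_eq fun_eq_iff)
  have q_perm: "q permutes ?E"
    unfolding q_alt using bE dE d_perm by (intro permutes_compose permutes_swap_id)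
  have q_e: "q e = ?b e" by (simp add: q_def remove_from_cycle_def)
  \<comment> \<open>The second half: the vertices of the minor are the cycles of \<open>q\<close>
    with \<open>e\<close> removed.\<close>
  have rem_q: "?b' \<circ> ?c' = remove_from_cycle e q"
    using inj by (auto simp: q_def remove_from_cycle_def inj_eq fun_eq_iff)
  have rq_perm: "remove_from_cycle e q permutes ?E'" using q_perm e by (rule remove_from_cycle_permutes)
  then have orbit_a': "orbit (sigma1 (minor1 G e)) = orbit (remove_from_cycle e q)"
    using orbit_inv_eq[of "remove_from_cycle e q"] fin
    by (fastforce simp: a' rem_q permutation_permutes fun_eq_iff)
  let ?Vd = "card (orbit d ` ?E)" and ?Vq = "card (orbit q ` ?E)"
    and ?V' = "card (orbit (remove_from_cycle e q) ` ?E')"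
    and ?A = "card (orbit ?b ` ?E)" and ?A' = "card (orbit ?b' ` ?E')"
    and ?B = "card (orbit ?c ` ?E)" and ?B' = "card (orbit ?c' ` ?E')"
    and ?K = "card (component G ` ?E)" and ?K' = "card (?C' ` ?E')"
  have counts: "?Vq = ?V' + (if ?b e = e then 1 else 0)"
      "?A = ?A' + (if ?b e = e then 1 else 0)" "?B = ?B' + (if ?c e = e then 1 else 0)"
    using card_orbits_remove_from_cycle[OF q_perm fin e] card_orbits_remove_from_cycle[OF perm(2) fin e]
      card_orbits_remove_from_cycle[OF perm(3) fin e] by (simp_all add: q_e)
  have cardE: "card ?E = card ?E' + 1" using fin e by (metis Suc_eq_plus1 card.remove)
  have genus: "genus G = ?K - (real ?Vd + ?A + ?B - card ?E) / 2"
    and genus': "genus (minor1 G e) = ?K' - (real ?V' + ?A' + ?B' - card ?E') / 2"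
    using genus_altdef[OF G] genus_altdef[OF G'] by (simp_all add: orbit_a orbit_a' E' b' c')
  have pd: "permutation d" using d_perm fin by (auto simp: permutation_permutes)
  have be_iff: "?b e \<in> orbit d (?b e)" "e \<in> orbit d e" "orbit d (d e) = orbit d e"
    using pd by (simp_all add: permutation_self_in_orbit permutation_orbit_step)
  have in_iff: "d e \<in> orbit d (?b e) \<longleftrightarrow> ?b e \<in> orbit d e"
    using be_iff orbit.base[of d e] orbit_eq_if_mem[OF pd, of "d e" "?b e"]
      orbit_eq_if_mem[OF pd, of "?b e" e] by auto
  have eq_iff: "d e = ?b e \<longleftrightarrow> ?c e = e" using inj by (simp add: d_def inj_eq)
  have Vq_fixed: "?Vq = ?Vd" if "?c e = e" using eq_iff that by (simp add: q_alt comp_def)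
  have Vq_split: "?Vq = ?Vd + 1" if "?c e \<noteq> e" "?b e \<in> orbit d e"
    using card_orbits_transpose_split[OF d_perm fin bE dE] that in_iff eq_iff by (simp add: q_alt)
  have Vq_merge: "?Vd = ?Vq + 1" if "?b e \<notin> orbit d e"
    using card_orbits_transpose_merge[OF d_perm fin bE dE] that in_iff by (simp add: q_alt)
  \<comment> \<open>Contracting a non-loop cannot disconnect: \<open>?b'\<close> leads from
    \<open>?c e\<close> straight to \<open>?b e\<close> if \<open>d e = e\<close>, and otherwise to
    \<open>d e\<close>, which lies at the same vertex of the minor as \<open>?b e\<close>.\<close>
  have joined: "?C' (?b e) = ?C' (?c e)"
    if ne: "?b e \<noteq> e" "?c e \<noteq> e" and sep: "?b e \<notin> orbit d e"
  proof (cases "d e = e")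
    case True
    then have "?b' (?c e) = ?b e" using ne by (simp add: d_def remove_from_cycle_def)
    then show ?thesis
      using component_step[of "?c e" "minor1 G e" ?b'] ne cE by (simp add: E' b')
  next
    case False
    then have "?b' (?c e) = d e" using ne by (simp add: d_def remove_from_cycle_def)
    then have 1: "?C' (d e) = ?C' (?c e)"
      using component_step[of "?c e" "minor1 G e" ?b'] ne cE by (simp add: E' b')
    have "d e \<in> orbit q (?b e)"
      using transpose_comp_orbit_merge[OF pd, of "d e" "?b e" "?b e"] sep in_iff be_iff orbit.base[of d e]
      by (simp add: q_alt)
    then have "d e \<in> orbit (remove_from_cycle e q) (?b e)"
      using False ne orbit_remove_from_cycle_permutes[OF q_perm fin e] by simp
    then have "d e \<in> orbit (sigma1 (minor1 G e)) (?b e)" by (simp add: orbit_a')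
    moreover have "orbit (sigma1 (minor1 G e)) (?b e) \<subseteq> ?C' (?b e) \<inter> ?E'"
    proof (rule orbit_subset_closed)
      show "?b e \<in> ?C' (?b e) \<inter> ?E'" using bE ne by (simp add: component_self)
      fix y assume y: "y \<in> ?C' (?b e) \<inter> ?E'"
      then have "y \<in> ?E'" by blast
      then have "sigma1 (minor1 G e) y \<in> ?E'" using G'
        unfolding alternating_dimap_def E' by (simp only: permutes_in_image)
      moreover have "?C' (sigma1 (minor1 G e) y) = ?C' y"
        using y by (intro component_step) (simp_all add: E')
      moreover have "?C' y = ?C' (?b e)"
        using y class_funD(3)[OF class_fun_component[OF G']] bE ne by (simp add: E')
      ultimately show "sigma1 (minor1 G e) y \<in> ?C' (?b e) \<inter> ?E'"
        using component_self by fastforce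
    qed
    ultimately have "?C' (d e) = ?C' (?b e)"
      using class_funD(3)[OF class_fun_component[OF G'], of "?b e" "d e"] bE ne by (auto simp: E')
    then show ?thesis using 1 by simp
  qed
  note K = card_component_minor1[OF G e]
  have sep_ne: "?b e \<noteq> e" if "?b e \<notin> orbit d e" using that be_iff by metis
  show eq: "genus (minor1 G e) = genus G" if "?b e \<notin> orbit ?a e"
  proof -
    have sep: "?b e \<notin> orbit d e" using that by (simp add: orbit_a)
    have "?c e \<noteq> e" using sep eq_iff be_iff by (metis orbit.base)
    then show ?thesis
      using K(3) joined[OF sep_ne[OF sep] _ sep] sep_ne[OF sep] Vq_merge[OF sep] counts cardE
      by (simp add: genus genus')
  qed
  show "genus (minor1 G e) = genus G \<or> genus (minor1 G e) = genus G - 1"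
  proof (cases "?b e \<in> orbit ?a e")
    case True
    then have mem: "?b e \<in> orbit d e" by (simp add: orbit_a)
    consider "?b e = e" "?c e = e" | "?b e \<noteq> e" "?c e = e" | "?b e = e" "?c e \<noteq> e"
      | "?b e \<noteq> e" "?c e \<noteq> e" by blast
    then show ?thesis
    proof cases
      case 1
      then show ?thesis using K(1) Vq_fixed counts cardE by (simp add: genus genus' field_simps)
    next
      case 2
      then show ?thesis using K(2) Vq_fixed counts cardE by (simp add: genus genus' field_simps)
    next
      case 3
      then show ?thesis using K(2) Vq_split[OF _ mem] counts cardE by (simp add: genus genus' field_simps)
    next
      case 4
      \<comment> \<open>One vertex more and one edge fewer raise \<open>V - E + F\<close> by two, so
        the genus drops by one unless a new component makes up for it.\<close>
      then show ?thesis using K(3) Vq_split[OF _ mem] counts cardE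
        by (cases "?C' (?b e) = ?C' (?c e)") (simp_all add: genus genus' field_simps)
    qed
  qed (use eq in blast)
qed


text \<open>Cyclically shifting the three permutations turns every reduction into \<^const>\<open>minor1\<close>.\<close>

definition trial :: "'e dimap \<Rightarrow> 'e dimap" where
  "trial G = \<lparr>edges = edges G, sigma1 = sigmaW2 G, sigmaW = sigma1 G, sigmaW2 = sigmaW G\<rparr>"

lemma trial_simps [simp]:
  "edges (trial G) = edges G" "sigma1 (trial G) = sigmaW2 G"
  "sigmaW (trial G) = sigma1 G" "sigmaW2 (trial G) = sigmaW G"
  by (simp_all add: trial_def)

lemma alternating_dimap_trial:
  assumes "alternating_dimap G"
  shows "alternating_dimap (trial G)"
proof -
  have "inj (sigmaW G)" using assms by (auto simp: alternating_dimap_def permutes_inj)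
  then have "sigmaW2 G (sigma1 G (sigmaW G x)) = x" for x
    using sigmaW_sigmaW2_sigma1[OF assms, of "sigmaW G x"] by (simp add: inj_eq)
  then show ?thesis using assms by (auto simp: alternating_dimap_def)
qed

lemma genus_trial:
  assumes "alternating_dimap G"
  shows "genus (trial G) = genus G"
proof -
  have "step_rel (trial G) = step_rel G" by (auto simp: step_rel_def)
  then have "component (trial G) = component G" by (simp add: component_def fun_eq_iff)
  then show ?thesis
    using genus_altdef[OF assms] genus_altdef[OF alternating_dimap_trial[OF assms]] by simp
qed

lemma trial_minorW: "trial (minorW G e) = minor1 (trial G) e"
  by (simp add: trial_def minor1_def minorW_def Let_def)

text \<open>\<open>minorW2\<close> writes its forced permutation as
  \<open>inv a \<circ> inv c\<close>; recognising this as the inverse of a composition takes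
  bijectivity, hence the hypotheses.\<close>

lemma trial_minorW2:
  assumes "alternating_dimap G" "e \<in> edges G"
  shows "trial (trial (minorW2 G e)) = minor1 (trial (trial G)) e"
proof -
  let ?a = "remove_from_cycle e (sigma1 G)" and ?c = "remove_from_cycle e (sigmaW2 G)"
  have "?a permutes (edges G - {e})" "?c permutes (edges G - {e})"
    using assms by (auto simp: alternating_dimap_def intro: remove_from_cycle_permutes)
  then have "inv (?c \<circ> ?a) = inv ?a \<circ> inv ?c" by (metis o_inv_distrib permutes_bij)
  then show ?thesis by (simp add: trial_def minor1_def minorW2_def Let_def)
qed

lemma genus_minorW:
  assumes G: "alternating_dimap G" and e: "e \<in> edges G"
  shows "genus (minorW G e) = genus G \<or> genus (minorW G e) = genus G - 1"
    and "sigma1 G e \<notin> orbit (sigmaW2 G) e \<Longrightarrow> genus (minorW G e) = genus G"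
  using genus_minor1[of "trial G" e] assms
  by (simp_all add: alternating_dimap_trial genus_trial minor_alternating_dimap flip: trial_minorW)

lemma genus_minorW2:
  assumes G: "alternating_dimap G" and e: "e \<in> edges G"
  shows "genus (minorW2 G e) = genus G \<or> genus (minorW2 G e) = genus G - 1"
    and "sigmaW2 G e \<notin> orbit (sigmaW G) e \<Longrightarrow> genus (minorW2 G e) = genus G"
  using genus_minor1[of "trial (trial G)" e] assms
  by (simp_all add: alternating_dimap_trial genus_trial minor_alternating_dimap flip: trial_minorW2)

section \<open>Monotonicity and integrality of the genus\<close>

lemma genus_minor_le:
  assumes "is_minor G H" "alternating_dimap G"
  shows "genus H \<le> genus G"
  using assms
proof induction
  case (minor1 H e)
  then show ?case using genus_minor1(1)[of H e] is_minor_alternating_dimap by fastforce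
next
  case (minorW H e)
  then show ?case using genus_minorW(1)[of H e] is_minor_alternating_dimap by fastforce
next
  case (minorW2 H e)
  then show ?case using genus_minorW2(1)[of H e] is_minor_alternating_dimap by fastforce
qed simp

text \<open>The empty dimap has genus 0 and each reduction changes the genus by an integer, so
  removing the edges one at a time gives integrality.\<close>

lemma genus_in_Ints:
  assumes "alternating_dimap G"
  shows "genus G \<in> \<int>"
  using assms
proof (induction "card (edges G)" arbitrary: G rule: less_induct)
  case (less G)
  show ?case
  proof (cases "edges G = {}")
    case True
    then show ?thesis using genus_altdef[OF less.prems] by simp
  next
    case False
    then obtain e where e: "e \<in> edges G" by blast
    have "edges (minor1 G e) = edges G - {e}" by (simp add: minor1_def Let_def)
    then have "genus (minor1 G e) \<in> \<int>"
      using less e finite_edges[OF less.prems] minor_alternating_dimap(1)[OF less.prems e]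
      by (intro less.hyps) (simp_all add: card_Diff1_less del: card_Diff_insert)
    moreover have "genus G = genus (minor1 G e) \<or> genus G = genus (minor1 G e) + 1"
      using genus_minor1(1)[OF less.prems e] by auto
    ultimately show ?thesis by auto
  qed
qed

section \<open>Disjoint unions of posies\<close>

text \<open>Each member is closed under its permutations, which agree there with those of
  \<open>G\<close>. Cycles and components of \<open>G\<close> through an edge of a member are
  therefore those of the member, and every term of the genus adds up.\<close>

lemma genus_disjoint_union:
  assumes "disjoint_union_of G Ps" and alt: "\<And>P. P \<in> Ps \<Longrightarrow> alternating_dimap P"
  shows "genus G = (\<Sum>P\<in>Ps. genus P)"
proof -
  have G: "alternating_dimap G" and fin: "finite Ps" and disj: "disjoint_family_on edges Ps"
    and E: "edges G = (\<Union>P\<in>Ps. edges P)"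
    and eq: "\<And>P e. P \<in> Ps \<Longrightarrow> e \<in> edges P \<Longrightarrow>
        sigma1 P e = sigma1 G e \<and> sigmaW P e = sigmaW G e \<and> sigmaW2 P e = sigmaW2 G e"
    using assms(1) unfolding disjoint_union_of_def by blast+
  have closed: "sigma1 P x \<in> edges P \<longleftrightarrow> x \<in> edges P" "sigmaW P x \<in> edges P \<longleftrightarrow> x \<in> edges P"
    "sigmaW2 P x \<in> edges P \<longleftrightarrow> x \<in> edges P" if "P \<in> Ps" for P x
    using alt[OF that] by (auto simp: alternating_dimap_def permutes_in_image)
  have orb: "orbit (sigma1 G) x = orbit (sigma1 P) x" "orbit (sigmaW G) x = orbit (sigmaW P) x"
    "orbit (sigmaW2 G) x = orbit (sigmaW2 P) x" if P: "P \<in> Ps" and x: "x \<in> edges P" for P x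
  proof -
    have *: "orbit s x = orbit t x" if "\<And>y. y \<in> edges P \<Longrightarrow> t y = s y \<and> t y \<in> edges P" for s t
      by (rule orbit_cong0[OF x]) (use that in force)+
    show "orbit (sigma1 G) x = orbit (sigma1 P) x" "orbit (sigmaW G) x = orbit (sigmaW P) x"
      "orbit (sigmaW2 G) x = orbit (sigmaW2 P) x"
      using eq[OF P] closed[OF P] by - (rule *, metis)+
  qed
  have comp: "component G x = component P x" if P: "P \<in> Ps" and x: "x \<in> edges P" for P x
  proof
    have f: "class_fun (edges P) (component P)" using alt[OF P] by (rule class_fun_component)
    show "component G x \<subseteq> component P x"
    proof (rule component_subset_closed)
      show "x \<in> component P x" by (rule component_self)
      fix y s assume y: "y \<in> edges G" and s: "s \<in> {sigma1 G, sigmaW G, sigmaW2 G}"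
      \<comment> \<open>The step may start in another member \<open>Q\<close>; its edges are
        disjoint from those of \<open>P\<close>, so then neither end lies in the component.\<close>
      obtain Q where Q: "Q \<in> Ps" "y \<in> edges Q" using y E by blast
      obtain t where t: "t \<in> {sigma1 Q, sigmaW Q, sigmaW2 Q}" "s y = t y"
        using s eq[OF Q] by (metis empty_iff insert_iff)
      have ty: "t y \<in> edges Q" using t closed[OF Q(1)] Q(2) by auto
      show "s y \<in> component P x \<longleftrightarrow> y \<in> component P x"
      proof (cases "Q = P")
        case True
        then have "component P (t y) = component P y" using component_step[OF Q(2) t(1)] by simp
        then show ?thesis using class_fun_mem_iff[OF f x] ty Q t True by simp
      next
        case False
        then have "edges Q \<inter> edges P = {}" using disj P Q by (auto simp: disjoint_family_on_def)
        then show ?thesis using class_funD(2)[OF f x] ty Q t by auto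
      qed
    qed
    have fG: "class_fun (edges G) (component G)" using G by (rule class_fun_component)
    show "component P x \<subseteq> component G x"
    proof (rule component_subset_closed)
      show "x \<in> component G x" by (rule component_self)
      fix y s assume y: "y \<in> edges P" and s: "s \<in> {sigma1 P, sigmaW P, sigmaW2 P}"
      obtain t where t: "t \<in> {sigma1 G, sigmaW G, sigmaW2 G}" "s y = t y"
        using s eq[OF P y] by (metis empty_iff insert_iff)
      have yG: "y \<in> edges G" "x \<in> edges G" "s y \<in> edges G"
      proof -
        have "s y \<in> edges P" using s y closed[OF P] by auto
        then show "y \<in> edges G" "x \<in> edges G" "s y \<in> edges G" using y x P E by blast+
      qed
      then have "component G (t y) = component G y" using component_step[OF _ t(1)] by simp
      then show "s y \<in> component G x \<longleftrightarrow> y \<in> component G x"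
        using class_fun_mem_iff[OF fG] yG t(2) by simp
    qed
  qed
  have finP: "finite (edges P)" if "P \<in> Ps" for P using alt[OF that] by (rule finite_edges)
  note sums = card_classes_disjoint_union[OF fin finP disj, folded E]
  have perm: "sigma1 P permutes edges P" "sigmaW P permutes edges P" "sigmaW2 P permutes edges P"
    if "P \<in> Ps" for P using alt[OF that] by (auto simp: alternating_dimap_def)
  have K: "card (component G ` edges G) = (\<Sum>P\<in>Ps. card (component P ` edges P))"
    using alt comp by (intro sums class_fun_component)
  have V: "card (orbit (sigma1 G) ` edges G) = (\<Sum>P\<in>Ps. card (orbit (sigma1 P) ` edges P))"
    using perm finP orb by (intro sums class_fun_orbit)
  have A: "card (orbit (sigmaW G) ` edges G) = (\<Sum>P\<in>Ps. card (orbit (sigmaW P) ` edges P))"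
    using perm finP orb by (intro sums class_fun_orbit)
  have C: "card (orbit (sigmaW2 G) ` edges G) = (\<Sum>P\<in>Ps. card (orbit (sigmaW2 P) ` edges P))"
    using perm finP orb by (intro sums class_fun_orbit)
  have cE: "card (edges G) = (\<Sum>P\<in>Ps. card (edges P))"
    using fin finP disj by (simp add: E card_UN_disjoint disjoint_family_on_def)
  have "(\<Sum>P\<in>Ps. genus P) = (\<Sum>P\<in>Ps. real (card (component P ` edges P)) -
    (real (card (orbit (sigma1 P) ` edges P)) + real (card (orbit (sigmaW P) ` edges P))
      + real (card (orbit (sigmaW2 P) ` edges P)) - real (card (edges P))) / 2)"
    using alt by (intro sum.cong genus_altdef) auto
  also have "\<dots> = genus G"
    unfolding genus_altdef[OF G] K V A C cE
    by (simp add: sum_subtractf sum.distrib flip: sum_divide_distrib)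
  finally show ?thesis by simp
qed

text \<open>With one component, one vertex, one a-face and one c-face, \<open>n\<close> edges give
  genus \<open>(n - 1) / 2\<close>. Integrality of the genus makes \<open>n\<close> odd, as a posy
  demands.\<close>

lemma posy_if_single_orbit:
  assumes P: "alternating_dimap P" and ne: "edges P \<noteq> {}"
    and orb: "\<And>p x. p \<in> {sigma1 P, sigmaW P, sigmaW2 P} \<Longrightarrow> x \<in> edges P \<Longrightarrow> orbit p x = edges P"
  shows "posy P"
proof -
  have img: "orbit p ` edges P = {edges P}" if "p \<in> {sigma1 P, sigmaW P, sigmaW2 P}" for p
    using orb[OF that] ne by auto
  have f: "class_fun (edges P) (component P)" using P by (rule class_fun_component)
  have "component P x = edges P" if x: "x \<in> edges P" for x
  proof
    show "component P x \<subseteq> edges P" using class_funD(2)[OF f x] .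
    have "orbit (sigma1 P) x \<subseteq> component P x"
    proof (rule orbit_subset_closed)
      fix y assume y: "y \<in> component P x"
      then have "component P (sigma1 P y) = component P x"
        using component_step[of y P "sigma1 P"] class_funD(2,3)[OF f x] by auto
      then show "sigma1 P y \<in> component P x" using component_self by metis
    qed (rule component_self)
    then show "edges P \<subseteq> component P x" using orb x by simp
  qed
  then have "component P ` edges P = {edges P}" using ne by auto
  then have "genus P = 1 - (3 - real (card (edges P))) / 2"
    using genus_altdef[OF P] by (simp add: img)
  moreover obtain m :: int where "genus P = m" using genus_in_Ints[OF P] by (elim Ints_cases)
  ultimately have "real_of_int (int (card (edges P))) = real_of_int (2 * m + 1)"
    by (simp add: field_simps)
  then have "int (card (edges P)) = 2 * m + 1" by (simp only: of_int_eq_iff)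
  \<comment> \<open>\<open>m\<close> is nonnegative because \<open>2 * m + 1\<close> is a
    cardinality.\<close>
  then have "card (edges P) = 2 * nat m + 1" by linarith
  moreover have "card (vertices P) = 1" "card (faces P) = 2"
    by (simp_all add: vertices_def faces_def a_faces_def c_faces_def img card_Plus)
  ultimately show ?thesis using P by (auto simp: posy_def k_posy_def)
qed

text \<open>An injective self-map of a finite set is onto, so forward closure suffices.\<close>

lemma perm_restrict_permutes:
  assumes "inj p" "finite A" "\<And>x. x \<in> A \<Longrightarrow> p x \<in> A"
  shows "perm_restrict p A permutes A"
proof (rule bij_imp_permutes)
  have "inj_on p A" using assms(1) by (rule inj_on_subset) simp
  moreover from this have "p ` A = A" using assms by (intro endo_inj_surj) auto
  ultimately show "bij_betw (perm_restrict p A) A A"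
    by (simp add: bij_betw_def inj_on_def perm_restrict_def)
qed (simp add: perm_restrict_def)

text \<open>\<open>perm_restrict\<close> is the identity outside \<open>A\<close>, as
  \<open>permutes\<close> requires.\<close>

definition restrict_dimap :: "'e dimap \<Rightarrow> 'e set \<Rightarrow> 'e dimap" where
  "restrict_dimap G A = \<lparr>edges = A, sigma1 = perm_restrict (sigma1 G) A,
    sigmaW = perm_restrict (sigmaW G) A, sigmaW2 = perm_restrict (sigmaW2 G) A\<rparr>"

lemma restrict_dimap_simps [simp]:
  "edges (restrict_dimap G A) = A" "sigma1 (restrict_dimap G A) = perm_restrict (sigma1 G) A"
  "sigmaW (restrict_dimap G A) = perm_restrict (sigmaW G) A"
  "sigmaW2 (restrict_dimap G A) = perm_restrict (sigmaW2 G) A"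
  by (simp_all add: restrict_dimap_def)

text \<open>A common cycle is invariant under all three permutations, and each of them restricts to
  a single cycle on it. So the restrictions of \<open>G\<close> to its vertex cycles are posies, and
  additivity gives their total genus.\<close>

lemma disjoint_union_of_posies_if_orbits_eq:
  assumes G: "alternating_dimap G"
    and orb: "\<And>x. x \<in> edges G \<Longrightarrow> orbit (sigmaW G) x = orbit (sigma1 G) x"
      "\<And>x. x \<in> edges G \<Longrightarrow> orbit (sigmaW2 G) x = orbit (sigma1 G) x"
    and k: "genus G = real k"
  shows "disjoint_union_of_posies G k"
proof -
  let ?V = "vertices G" and ?Ps = "restrict_dimap G ` vertices G"
  have fin: "finite (edges G)" and prod: "sigma1 G \<circ> sigmaW G \<circ> sigmaW2 G = id"
    and perm: "\<And>p. p \<in> {sigma1 G, sigmaW G, sigmaW2 G} \<Longrightarrow> p permutes edges G"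
    using G by (auto simp: alternating_dimap_def)
  have f: "class_fun (edges G) (orbit (sigma1 G))" using perm fin by (intro class_fun_orbit) auto
  have V_sub: "A \<subseteq> edges G" if "A \<in> ?V" for A
    using that class_funD(2)[OF f] by (auto simp: vertices_def)
  have V_orb: "orbit p x = A"
    if A: "A \<in> ?V" and x: "x \<in> A" and p: "p \<in> {sigma1 G, sigmaW G, sigmaW2 G}" for A x p
  proof -
    obtain z where "z \<in> edges G" "A = orbit (sigma1 G) z" using A by (auto simp: vertices_def)
    then have "orbit (sigma1 G) x = A" using class_funD(3)[OF f] x by blast
    moreover have "x \<in> edges G" using V_sub A x by blast
    ultimately show ?thesis using p orb by auto
  qed
  have posy: "posy (restrict_dimap G A)" if A: "A \<in> ?V" for A
  proof (rule posy_if_single_orbit)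
    have ne: "A \<noteq> {}" using A by (auto simp: vertices_def orbit_nonempty)
    then show "edges (restrict_dimap G A) \<noteq> {}" by simp
    have closed: "p x \<in> A" if "x \<in> A" "p \<in> {sigma1 G, sigmaW G, sigmaW2 G}" for p x
      using V_orb[OF A that] orbit.base by metis
    have finA: "finite A" using ne V_sub[OF A] fin finite_subset by blast
    have pr: "perm_restrict p A permutes A" if "p \<in> {sigma1 G, sigmaW G, sigmaW2 G}" for p
      using that closed finA permutes_inj[OF perm] by (intro perm_restrict_permutes) auto
    have "sigma1 G (sigmaW G (sigmaW2 G x)) = x" for x using fun_cong[OF prod, of x] by simp
    then show "alternating_dimap (restrict_dimap G A)"
      using closed by (auto simp: alternating_dimap_def finA pr perm_restrict_def fun_eq_iff)
    fix p x assume p: "p \<in> {sigma1 (restrict_dimap G A), sigmaW (restrict_dimap G A),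
      sigmaW2 (restrict_dimap G A)}" and "x \<in> edges (restrict_dimap G A)"
    then have x: "x \<in> A" by simp
    obtain q where q: "q \<in> {sigma1 G, sigmaW G, sigmaW2 G}" "p = perm_restrict q A"
      using p by auto
    have "orbit p x = orbit q x"
      by (rule orbit_cong0[of x A, symmetric, OF x])
        (use closed q in \<open>auto simp: perm_restrict_def\<close>)
    then show "orbit p x = edges (restrict_dimap G A)" using V_orb[OF A x q(1)] by simp
  qed
  have du: "disjoint_union_of G ?Ps"
    unfolding disjoint_union_of_def
  proof (intro conjI)
    show "disjoint_family_on edges ?Ps"
      using class_fun_disjoint[OF f] by (fastforce simp: disjoint_family_on_def vertices_def)
    have "\<Union>?V = edges G" using class_funD(1,2)[OF f] unfolding vertices_def by blast
    then show "edges G = (\<Union>P\<in>?Ps. edges P)" by simp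
  qed (use G fin in \<open>auto simp: vertices_def perm_restrict_def\<close>)
  moreover have "\<forall>P\<in>?Ps. posy P" using posy by blast
  moreover have "(\<Sum>P\<in>?Ps. genus P) = real k"
  proof -
    have "alternating_dimap P" if "P \<in> ?Ps" for P
      using that posy unfolding posy_def k_posy_def by blast
    then show ?thesis using genus_disjoint_union[OF du] k by simp
  qed
  ultimately show ?thesis unfolding disjoint_union_of_posies_def by blast
qed

section \<open>Minors with fewest edges among those of genus at least \<open>k\<close>\<close>

lemma orbit_subset_orbit:
  assumes p: "p permutes E" "finite E" and x: "x \<in> E" and q: "\<And>y. y \<in> E \<Longrightarrow> q y \<in> orbit p y"
  shows "orbit q x \<subseteq> orbit p x"
proof (rule orbit_subset_closed)
  have f: "class_fun E (orbit p)" using p by (rule class_fun_orbit)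
  show "x \<in> orbit p x" using class_funD(1)[OF f x] .
  fix y assume "y \<in> orbit p x"
  then show "q y \<in> orbit p x" using class_funD(2,3)[OF f x] q by blast
qed

theorem theorem21:
  fixes G :: "'e dimap" and k :: nat
  assumes "alternating_dimap G" and "edges G \<noteq> {}"
  shows "genus G < real k \<longleftrightarrow> \<not> (\<exists>H. is_minor G H \<and> disjoint_union_of_posies H k)"
proof
  assume less: "genus G < real k"
  show "\<not> (\<exists>H. is_minor G H \<and> disjoint_union_of_posies H k)"
  proof
    assume "\<exists>H. is_minor G H \<and> disjoint_union_of_posies H k"
    then obtain H Ps where H: "is_minor G H" "disjoint_union_of H Ps" "\<forall>P\<in>Ps. posy P"
      "(\<Sum>P\<in>Ps. genus P) = real k" unfolding disjoint_union_of_posies_def by blast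
    have "genus H = real k"
      using genus_disjoint_union[OF H(2)] H(3,4) by (auto simp: posy_def k_posy_def)
    then show False using genus_minor_le[OF H(1) assms(1)] less by simp
  qed
next
  assume none: "\<not> (\<exists>H. is_minor G H \<and> disjoint_union_of_posies H k)"
  show "genus G < real k"
  proof (rule ccontr)
    assume "\<not> genus G < real k"
    then have "is_minor G G \<and> genus G \<ge> real k" by (simp add: is_minor.refl)
    then obtain H where H: "is_minor G H" "genus H \<ge> real k"
      and min: "\<And>H'. is_minor G H' \<Longrightarrow> genus H' \<ge> real k \<Longrightarrow> card (edges H) \<le> card (edges H')"
      using ex_has_least_nat[of "\<lambda>H. is_minor G H \<and> genus H \<ge> real k" G "\<lambda>H. card (edges H)"]
      by blast
    have alt: "alternating_dimap H" using H(1) assms(1) by (rule is_minor_alternating_dimap)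
    let ?E = "edges H"
    \<comment> \<open>A reduction loses an edge, so by minimality it must fall below genus
      \<open>k\<close>.\<close>
    have small: "genus H' < real k" if "is_minor G H'" "edges H' = ?E - {e}" "e \<in> ?E" for H' e
    proof (rule ccontr)
      assume "\<not> genus H' < real k"
      then have "card ?E \<le> card (?E - {e})" using min[OF that(1)] that(2) by simp
      then show False using card_Diff1_less[OF finite_edges[OF alt] that(3)] by simp
    qed
    have less: "genus (minor1 H e) < real k" "genus (minorW H e) < real k"
      "genus (minorW2 H e) < real k" if "e \<in> ?E" for e
      using small[OF is_minor.minor1[OF H(1) that] _ that]
        small[OF is_minor.minorW[OF H(1) that] _ that]
        small[OF is_minor.minorW2[OF H(1) that] _ that]
      by (simp_all add: minor1_def minorW_def minorW2_def Let_def)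
    \<comment> \<open>Every reduction lowers the genus here, so the criterion for preserving it
      fails at every edge.\<close>
    have mem: "sigmaW H e \<in> orbit (sigma1 H) e" "sigma1 H e \<in> orbit (sigmaW2 H) e"
      "sigmaW2 H e \<in> orbit (sigmaW H) e" if "e \<in> ?E" for e
      using less[OF that] H(2) genus_minor1(2)[OF alt that] genus_minorW(2)[OF alt that]
        genus_minorW2(2)[OF alt that] by fastforce+
    have fin: "finite ?E" and perm: "sigma1 H permutes ?E" "sigmaW H permutes ?E"
      "sigmaW2 H permutes ?E" using alt by (auto simp: alternating_dimap_def)
    \<comment> \<open>The three inclusions between cycles form a closed chain and are therefore
      equalities.\<close>
    have orb: "orbit (sigmaW H) x = orbit (sigma1 H) x"
      "orbit (sigmaW2 H) x = orbit (sigma1 H) x" if "x \<in> ?E" for x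
      using orbit_subset_orbit[OF perm(1) fin that mem(1)]
        orbit_subset_orbit[OF perm(3) fin that mem(2)]
        orbit_subset_orbit[OF perm(2) fin that mem(3)] by auto
    \<comment> \<open>The genus is an integer, at least \<open>k\<close>, and a reduction lowering
      it by at most one takes it below \<open>k\<close>. Without edges the genus is 0, which forces
      \<open>k = 0\<close>.\<close>
    have "genus H = real k"
    proof (cases "?E = {}")
      case True
      then have "genus H = 0" using genus_altdef[OF alt] by simp
      then show ?thesis using H(2) by simp
    next
      case False
      then obtain e where e: "e \<in> ?E" by blast
      obtain m :: int where m: "genus H = m" using genus_in_Ints[OF alt] by (elim Ints_cases)
      have "genus H < real k + 1" using genus_minor1(1)[OF alt e] less(1)[OF e] by auto
      then have "real_of_int m < real_of_int (int k + 1)" "real_of_int (int k) \<le> real_of_int m"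
        using m H(2) by simp_all
      then have "m = int k" by (simp only: of_int_less_iff of_int_le_iff)
      then show ?thesis using m by simp
    qed
    then have "disjoint_union_of_posies H k"
      using alt orb by (intro disjoint_union_of_posies_if_orbits_eq)
    then show False using H(1) none by blast
  qed
qed

end
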